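(* Let $Q\subseteq\mathbb{F}_4^n$ be an additive code with $4^k$ codewords, and let $B=\phi(Q^\perp)^\perp$ (binary dual of the binary image of the trace dual of $Q$). Then: (i) $B$ is a linear binary $[3n,n+2k]$ code; (ii) if $w$ is a weight of $Q^\perp$ occurring with frequency $A_w$, then $2w$ is a weight of $B^\perp$ with frequency $A_w$, and all weights of $B^\perp$ arise in this way; (iii) the coset graphs $\Gamma_Q$ and $\Gamma_B$ are isomorphic.
   Context: $\mathbb{F}_4=\{0,1,\omega,\omega^2\}$ with $\omega^2=\omega+1$; $\mathrm{Tr}(z)=z+z^2$. An additive code of length $n$ over $\mathbb{F}_4$ is an additive subgroup of $\mathbb{F}_4^n$; its dual $Q^\perp$ is taken with respect to the trace inner product $x*y=\sum_i\mathrm{Tr}(x_iy_i^2)$. The map $\phi:\mathbb{F}_4\to\mathbb{F}_2^3$ is $\phi(a+b\omega)=(b,a+b,a)$ for $a,b\in\mathbb{F}_2$ (equivalently $\phi(c)=(\mathrm{Tr}(c),\mathrm{Tr}(\omega c),\mathrm{Tr}(\omega^2c))$), extended coordinatewise to $\mathbb{F}_4^n\to\mathbb{F}_2^{3n}$. Binary duals use the standard inner product. The coset graph of a code $C$ (additive quaternary or linear binary) has as vertices the cosets of $C$ in the ambient space, two cosets being adjacent if their difference contains a vector of Hamming weight $1$. *)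

theory Defs
  imports
    "HOL-Analysis.Analysis"
    "HOL-Library.Z2"
    "HOL-Library.Set_Algebras"
    "Graph_Theory.Pair_Digraph"
    "Graph_Theory.Digraph_Isomorphism"
begin

text \<open>The field with four elements: \<open>F4 a b\<close> stands for \<open>a + b \<omega>\<close>, where \<open>\<omega>\<^sup>2 = \<omega> + 1\<close>.\<close>

datatype f4 = F4 bit bit

definition omega :: f4 (\<open>\<omega>\<close>) where
  "\<omega> = F4 0 1"

instantiation f4 :: field
begin

definition zero_f4 :: f4 where "0 = F4 0 0"

definition one_f4 :: f4 where "1 = F4 1 0"

fun plus_f4 :: "f4 \<Rightarrow> f4 \<Rightarrow> f4" where
  "F4 a b + F4 c d = F4 (a + c) (b + d)"

definition uminus_f4 :: "f4 \<Rightarrow> f4" where "- z = (z :: f4)"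

definition minus_f4 :: "f4 \<Rightarrow> f4 \<Rightarrow> f4" where "z - w = z + (w :: f4)"

fun times_f4 :: "f4 \<Rightarrow> f4 \<Rightarrow> f4" where
  "F4 a b * F4 c d = F4 (a * c + b * d) (a * d + b * c + b * d)"

text \<open>Every nonzero \<open>z\<close> satisfies \<open>z\<^sup>3 = 1\<close>, so its inverse is \<open>z\<^sup>2\<close>.\<close>

definition inverse_f4 :: "f4 \<Rightarrow> f4" where "inverse z = z * (z :: f4)"

definition divide_f4 :: "f4 \<Rightarrow> f4 \<Rightarrow> f4" where "z div w = z * inverse (w :: f4)"

instance
proof
  fix x y z :: f4
  show "x * y * z = x * (y * z)"
    by (cases x; cases y; cases z) (simp only: plus_f4.simps times_f4.simps algebra_simps)
  show "x * y = y * x"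
    by (cases x; cases y) (simp only: plus_f4.simps times_f4.simps algebra_simps)
  show "1 * x = x"
    by (cases x) (simp add: one_f4_def)
  show "x + y + z = x + (y + z)"
    by (cases x; cases y; cases z) (simp only: plus_f4.simps times_f4.simps algebra_simps)
  show "x + y = y + x"
    by (cases x; cases y) (simp only: plus_f4.simps times_f4.simps algebra_simps)
  show "0 + x = x"
    by (cases x) (simp add: zero_f4_def)
  show "- x + x = 0"
    by (cases x) (simp add: zero_f4_def uminus_f4_def)
  show "x - y = x + - y"
    by (simp add: minus_f4_def uminus_f4_def)
  show "(x + y) * z = x * z + y * z"
    by (cases x; cases y; cases z) (simp only: plus_f4.simps times_f4.simps algebra_simps)
  show "(0 :: f4) \<noteq> 1"
    by (simp add: zero_f4_def one_f4_def)
  show "inverse x * x = 1" if "x \<noteq> 0"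
  proof (cases x)
    case (F4 a b)
    with that show ?thesis
      by (cases a; cases b) (simp_all add: inverse_f4_def one_f4_def zero_f4_def)
  qed
  show "x div y = x * inverse y"
    by (rule divide_f4_def)
  show "inverse (0 :: f4) = 0"
    by (simp add: inverse_f4_def zero_f4_def)
qed

end

lemma omega_squared: "\<omega>\<^sup>2 = \<omega> + 1"
  by (simp add: omega_def one_f4_def power2_eq_square)

lemma UNIV_f4: "(UNIV :: f4 set) = {0, 1, \<omega>, \<omega>\<^sup>2}"
proof -
  have "x \<in> {0, 1, \<omega>, \<omega>\<^sup>2}" for x :: f4
  proof (cases x)
    case (F4 a b)
    then show ?thesis
      by (cases a; cases b)
        (simp_all add: omega_def one_f4_def zero_f4_def power2_eq_square)
  qed
  then show ?thesis by blast
qed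

lemma F4_eq: "F4 a b = of_bit a + of_bit b * \<omega>"
  by (cases a; cases b) (simp_all add: omega_def one_f4_def zero_f4_def)

text \<open>The trace takes its values in the prime field \<open>{0, 1}\<close> of \<open>f4\<close>.\<close>

definition Tr :: "f4 \<Rightarrow> f4" where
  "Tr z = z + z\<^sup>2"

definition trace_inner :: "f4 ^ 'n \<Rightarrow> f4 ^ 'n \<Rightarrow> f4" where
  "trace_inner x y = (\<Sum>i\<in>UNIV. Tr (x $ i * (y $ i)\<^sup>2))"

definition additive_code :: "(f4 ^ 'n) set \<Rightarrow> bool" where
  "additive_code Q \<longleftrightarrow>
     0 \<in> Q \<and> (\<forall>x\<in>Q. \<forall>y\<in>Q. x + y \<in> Q) \<and> (\<forall>x\<in>Q. - x \<in> Q)"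

definition trace_dual :: "(f4 ^ 'n) set \<Rightarrow> (f4 ^ 'n) set" where
  "trace_dual Q = {y. \<forall>x\<in>Q. trace_inner x y = 0}"

definition binary_dual :: "(bit ^ 'm) set \<Rightarrow> (bit ^ 'm) set" where
  "binary_dual C = {y. \<forall>x\<in>C. scalar_product x y = 0}"

fun phi :: "f4 \<Rightarrow> bit ^ 3" where
  "phi (F4 a b) = vector [b, a + b, a]"

lemma phi_trace:
  "of_bit (phi c $ 1) = Tr c"
  "of_bit (phi c $ 2) = Tr (\<omega> * c)"
  "of_bit (phi c $ 3) = Tr (\<omega>\<^sup>2 * c)"
proof -
  obtain a b where "c = F4 a b" by (cases c)
  then show "of_bit (phi c $ 1) = Tr c"
    "of_bit (phi c $ 2) = Tr (\<omega> * c)"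
    "of_bit (phi c $ 3) = Tr (\<omega>\<^sup>2 * c)"
    by (cases a; cases b;
        simp add: Tr_def omega_def one_f4_def zero_f4_def power2_eq_square vector_3)+
qed

text \<open>The \<open>3n\<close> binary coordinates are indexed by pairs: \<open>(i, j)\<close> is the \<open>j\<close>-th of the three
  coordinates of the image of the \<open>i\<close>-th quaternary coordinate.\<close>

definition Phi :: "f4 ^ 'n \<Rightarrow> bit ^ ('n \<times> 3)" where
  "Phi x = (\<chi> p. phi (x $ fst p) $ snd p)"

definition hamming_weight :: "'a::zero ^ 'n \<Rightarrow> nat" where
  "hamming_weight x = card {i. x $ i \<noteq> 0}"

definition weight_freq :: "('a::zero ^ 'n) set \<Rightarrow> nat \<Rightarrow> nat" where
  "weight_freq C w = card {x \<in> C. hamming_weight x = w}"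

definition is_weight :: "('a::zero ^ 'n) set \<Rightarrow> nat \<Rightarrow> bool" where
  "is_weight C w \<longleftrightarrow> (\<exists>x\<in>C. hamming_weight x = w)"

text \<open>Binary linear \<open>[N, K]\<close> codes. The parameter \<open>K\<close> is real so that it can be given
  as \<open>n + 2k\<close> for a half-integer \<open>k\<close>.\<close>

definition binary_linear_code :: "(bit ^ 'm) set \<Rightarrow> nat \<Rightarrow> real \<Rightarrow> bool" where
  "binary_linear_code C N K \<longleftrightarrow>
     CARD('m) = N \<and> vec.subspace C \<and> real (vec.dim C) = K"

text \<open>Adjacency is a symmetric relation, so the graph is represented by the digraph having
  both orientations of every edge. A coset is adjacent to itself exactly when the code contains
  a vector of weight 1.\<close>

definition coset_graph :: "('a::ab_group_add ^ 'n) set \<Rightarrow> ('a ^ 'n) set pair_pre_digraph" where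
  "coset_graph C =
     (let V = range (\<lambda>v. v +o C) in
      \<lparr> pverts = V,
        parcs = {(X, Y) \<in> V \<times> V. \<exists>x\<in>X. \<exists>y\<in>Y. hamming_weight (x - y) = 1} \<rparr>)"

end

theory Submission
  imports Defs
begin

text \<open>The map \<open>\<phi>\<close> has an adjoint \<open>\<Psi>\<close>, a surjective additive map from the binary to the
  quaternary space with \<open>x * \<Psi> y = \<phi> x \<cdot> y\<close>. Its kernel consists of the vectors that are constant
  on every block of three coordinates, and the orthogonal of this kernel is the image of \<open>\<phi>\<close>.
  Hence \<open>(\<Psi>\<inverse> Q)\<^sup>\<bottom> = \<phi> (Q\<^sup>\<bottom>)\<close>, and binary double duality gives
  \<open>B = \<Psi>\<inverse> Q\<close> and \<open>B\<^sup>\<bottom> = \<phi> (Q\<^sup>\<bottom>)\<close>.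
  The dimension follows by counting fibres of \<open>\<Psi>\<close>, the weights because \<open>\<phi>\<close> doubles them, and the
  graph isomorphism because \<open>\<Psi>\<close> maps the vectors of weight 1 onto the vectors of weight 1.\<close>

declare add_bit_eq_xor [simp del] mult_bit_eq_and [simp del]

section \<open>Binary linear codes\<close>

lemma scalar_product_commute:
  fixes x y :: "'a::comm_semiring_1 ^ 'm"
  shows "scalar_product x y = scalar_product y x"
  by (simp add: scalar_product_def mult.commute)

text \<open>The only scalars are 0 and 1, so closure under scaling comes for free once 0 lies in
  \<open>S\<close>.\<close>

lemma subspace_bit_iff:
  fixes S :: "(bit ^ 'm) set"
  shows "vec.subspace S \<longleftrightarrow> 0 \<in> S \<and> (\<forall>x\<in>S. \<forall>y\<in>S. x + y \<in> S)"
proof -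
  have "c *s x \<in> S" if "0 \<in> S" "x \<in> S" for c :: bit and x
    using that by (cases c) auto
  then show ?thesis
    by (auto simp: vec.subspace_def)
qed

text \<open>The substantial half of double duality. A basis of \<open>S\<close> stays independent
  when \<open>v\<close> is added, so some linear map kills \<open>S\<close> but not
  \<open>v\<close>; a row of its matrix is the required \<open>y\<close>.\<close>

lemma exists_orthogonal_separator:
  fixes S :: "('a::field ^ 'm) set"
  assumes "vec.subspace S" and "v \<notin> S"
  obtains y where "\<And>x. x \<in> S \<Longrightarrow> scalar_product x y = 0" and "scalar_product v y \<noteq> 0"
proof -
  obtain b where b: "b \<subseteq> S" "vec.independent b" "S \<subseteq> vec.span b"
    by (rule vec.basis_exists)
  have span: "vec.span b = S"
    using b assms(1) by (metis subset_antisym vec.span_minimal)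
  then have ind: "vec.independent (insert v b)"
    using b(2) assms(2) by (simp add: vec.independent_insert)
  obtain g :: "'a ^ 'm \<Rightarrow> 'a ^ 'm" where g: "Vector_Spaces.linear (*s) (*s) g"
    "\<And>x. x \<in> insert v b \<Longrightarrow> g x = (if x = v then 1 else 0)"
    using vec.linear_independent_extend[OF ind, of "\<lambda>x. if x = v then 1 else 0"] by blast
  \<comment> \<open>The index is arbitrary: \<open>g v\<close> is the all-ones vector, so every row
    of \<open>matrix g\<close> separates \<open>v\<close> from \<open>S\<close>.\<close>
  obtain i :: 'm where True by simp
  have row: "scalar_product x (row i (matrix g)) = g x $ i" for x
  proof -
    have "g x $ i = (matrix g *v x) $ i"
      by (simp add: matrix_works[OF g(1)])
    then show ?thesis
      by (simp add: matrix_vector_mult_def scalar_product_def row_def mult.commute)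
  qed
  have "g x = 0" if "x \<in> S" for x
  proof (rule vec.linear_eq_0_on_span[OF g(1)])
    show "g y = 0" if "y \<in> b" for y
      using g(2)[of y] that b(1) assms(2) by auto
    show "x \<in> vec.span b" using that span by simp
  qed
  then show thesis
    using that[of "row i (matrix g)"] g(2)[of v] by (simp add: row)
qed

lemma binary_dual_dual:
  assumes "vec.subspace S"
  shows "binary_dual (binary_dual S) = S"
proof
  show "S \<subseteq> binary_dual (binary_dual S)"
    by (auto simp: binary_dual_def scalar_product_commute)
  show "binary_dual (binary_dual S) \<subseteq> S"
  proof
    fix v assume v: "v \<in> binary_dual (binary_dual S)"
    show "v \<in> S"
    proof (rule ccontr)
      assume "v \<notin> S"
      then obtain y where "\<And>x. x \<in> S \<Longrightarrow> scalar_product x y = 0" "scalar_product v y \<noteq> 0"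
        using exists_orthogonal_separator[OF assms] by blast
      with v show False
        by (auto simp: binary_dual_def scalar_product_commute[of v])
    qed
  qed
qed

text \<open>Each new independent vector \<open>a\<close> doubles the span: over two scalars it adds
  just the translate by \<open>a\<close>, which is disjoint from the old span. Finiteness is carried
  through the induction to count the union.\<close>

lemma card_span_bit:
  fixes b :: "(bit ^ 'm) set"
  assumes "vec.independent b"
  shows "finite (vec.span b) \<and> card (vec.span b) = 2 ^ card b"
proof -
  have "finite b"
    using assms vec.finiteI_independent by blast
  then show ?thesis
    using assms
  proof (induction b)
    case empty
    then show ?case by simp
  next
    case (insert a b)
    then have a: "a \<notin> vec.span b" and ind: "vec.independent b"
      by (simp_all add: vec.independent_insert)
    have IH: "finite (vec.span b)" "card (vec.span b) = 2 ^ card b"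
      using insert.IH ind by auto
    have "vec.span (insert a b) = vec.span b \<union> (\<lambda>x. x + a) ` vec.span b"
    proof -
      have "(\<exists>k. x - k *s a \<in> vec.span b) \<longleftrightarrow> x - 0 *s a \<in> vec.span b \<or> x - 1 *s a \<in> vec.span b" for x
        by (metis bit.exhaust)
      moreover have "x - a \<in> vec.span b \<longleftrightarrow> x \<in> (\<lambda>x. x + a) ` vec.span b" for x
        by (auto simp: image_iff) (metis diff_add_cancel)
      ultimately show ?thesis
        unfolding vec.span_insert by auto
    qed
    moreover have "vec.span b \<inter> (\<lambda>x. x + a) ` vec.span b = {}"
      using a by (auto simp: vec.span_add_eq)
    moreover have "card ((\<lambda>x. x + a) ` vec.span b) = card (vec.span b)"
      by (rule card_image) simp
    ultimately show ?case
      using IH insert.hyps by (simp add: card_Un_disjoint)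
  qed
qed

lemma card_subspace_bit:
  fixes S :: "(bit ^ 'm) set"
  assumes "vec.subspace S"
  shows "card S = 2 ^ vec.dim S"
proof -
  obtain b where b: "b \<subseteq> S" "vec.independent b" "S \<subseteq> vec.span b" "card b = vec.dim S"
    using vec.basis_exists[of S] by blast
  then have "vec.span b = S"
    using assms by (metis subset_antisym vec.span_minimal)
  then show ?thesis
    using card_span_bit[OF b(2)] b(4) by simp
qed

section \<open>Coset graphs\<close>

text \<open>An arc of a pair digraph is the pair of its ends, so the vertex map \<open>f\<close>
  already dictates the arc map.\<close>

lemma digraph_iso_with_projI:
  assumes "inj_on f (pverts G)" and "pverts H = f ` pverts G"
    and "parcs G \<subseteq> pverts G \<times> pverts G" and "parcs H = map_prod f f ` parcs G"
  shows "digraph_iso (with_proj G) (with_proj H)"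
proof -
  let ?h = "\<lparr>iso_verts = f, iso_arcs = map_prod f f, iso_head = snd, iso_tail = fst\<rparr>"
  have "inj_on (map_prod f f) (parcs G)"
    using map_prod_inj_on[OF assms(1) assms(1)] assms(3) by (rule inj_on_subset)
  then have "pre_digraph.digraph_isomorphism (with_proj G) ?h"
    using assms(1,3) by (auto simp: pre_digraph.digraph_isomorphism_def wf_digraph_def)
  moreover have "with_proj H = app_iso ?h (with_proj G)"
    using assms(2,4) by (simp add: app_iso_def with_proj_def)
  ultimately show ?thesis
    unfolding digraph_iso_def by blast
qed

lemma mem_coset_iff:
  fixes x u :: "'a::ab_group_add"
  shows "x \<in> u +o D \<longleftrightarrow> x - u \<in> D"
  by (auto simp: elt_set_plus_def) (metis diff_add_cancel add.commute)

text \<open>The isomorphism sends a coset to its preimage under \<open>f\<close>. Surjectivity makes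
  this injective; \<open>wt\<close> and \<open>lift\<close> transfer adjacency in the two
  directions.\<close>

lemma coset_graph_vimage_iso:
  fixes f :: "'a::ab_group_add ^ 'm \<Rightarrow> 'b::ab_group_add ^ 'n"
  assumes diff: "\<And>x y. f (x - y) = f x - f y" and "surj f"
    and wt: "\<And>x. hamming_weight x = 1 \<Longrightarrow> hamming_weight (f x) = 1"
    and lift: "\<And>y. hamming_weight y = 1 \<Longrightarrow> \<exists>x. hamming_weight x = 1 \<and> f x = y"
  shows "digraph_iso (with_proj (coset_graph C)) (with_proj (coset_graph (f -` C)))"
proof -
  define V where "V = range (\<lambda>v. v +o C)"
  define W where "W = range (\<lambda>v. v +o (f -` C))"
  have coset: "f -` (f u +o C) = u +o (f -` C)" for u
    by (auto simp: mem_coset_iff diff)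
  have VW: "W = (-`) f ` V"
  proof -
    \<comment> \<open>Since \<open>f\<close> is onto, every coset of \<open>C\<close> has a
      representative of the form \<open>f u\<close>.\<close>
    have "V = range (\<lambda>u. f u +o C)"
      using \<open>surj f\<close> by (simp add: V_def flip: image_image[of "\<lambda>v. v +o C" f])
    then show ?thesis
      by (simp add: W_def image_image coset)
  qed
  have inj: "inj_on ((-`) f) V"
    using \<open>surj f\<close> by (metis inj_onI surj_image_vimage_eq)
  have adj: "(\<exists>x\<in>f -` X. \<exists>y\<in>f -` Y. hamming_weight (x - y) = 1)
    \<longleftrightarrow> (\<exists>x\<in>X. \<exists>y\<in>Y. hamming_weight (x - y) = 1)" for X Y
  proof
    assume "\<exists>x\<in>X. \<exists>y\<in>Y. hamming_weight (x - y) = 1"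
    then obtain x y where xy: "x \<in> X" "y \<in> Y" "hamming_weight (x - y) = 1" by blast
    obtain u where u: "f u = x" using \<open>surj f\<close> by (metis surjD)
    \<comment> \<open>Lifting the difference rather than \<open>y\<close> itself gives the preimages
      \<open>u\<close> and \<open>u - e\<close>, which differ by a vector of weight 1.\<close>
    obtain e where e: "hamming_weight e = 1" "f e = x - y" using lift xy(3) by blast
    have "f (u - e) = y" by (simp add: diff u e)
    then show "\<exists>x\<in>f -` X. \<exists>y\<in>f -` Y. hamming_weight (x - y) = 1"
      using xy u e(1) by (intro bexI[of _ u] bexI[of _ "u - e"]) auto
  next
    assume "\<exists>x\<in>f -` X. \<exists>y\<in>f -` Y. hamming_weight (x - y) = 1"
    then show "\<exists>x\<in>X. \<exists>y\<in>Y. hamming_weight (x - y) = 1"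
      by (metis diff wt vimage_eq)
  qed
  show ?thesis
  proof (rule digraph_iso_with_projI)
    show "inj_on ((-`) f) (pverts (coset_graph C))"
      using inj by (simp add: coset_graph_def Let_def V_def)
    show "pverts (coset_graph (f -` C)) = (-`) f ` pverts (coset_graph C)"
      using VW by (simp add: coset_graph_def Let_def V_def W_def)
    show "parcs (coset_graph C) \<subseteq> pverts (coset_graph C) \<times> pverts (coset_graph C)"
      by (auto simp: coset_graph_def Let_def)
    have "{(X, Y) \<in> W \<times> W. \<exists>x\<in>X. \<exists>y\<in>Y. hamming_weight (x - y) = 1}
      = map_prod ((-`) f) ((-`) f) ` {(X, Y) \<in> V \<times> V. \<exists>x\<in>X. \<exists>y\<in>Y. hamming_weight (x - y) = 1}"
      (is "?L = ?R")
    proof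
      show "?L \<subseteq> ?R"
      proof clarify
        fix X' Y' x y assume "X' \<in> W" "Y' \<in> W" and *: "x \<in> X'" "y \<in> Y'" "hamming_weight (x - y) = 1"
        then obtain X Y where "X \<in> V" "Y \<in> V" and XY: "X' = f -` X" "Y' = f -` Y"
          unfolding VW by blast
        moreover have "\<exists>x\<in>X. \<exists>y\<in>Y. hamming_weight (x - y) = 1"
          using * unfolding XY adj[symmetric] by blast
        ultimately show "(X', Y') \<in> ?R"
          by (intro image_eqI[of _ _ "(X, Y)"]) simp_all
      qed
      show "?R \<subseteq> ?L"
        using adj by (fastforce simp: VW)
    qed
    then show "parcs (coset_graph (f -` C))
      = map_prod ((-`) f) ((-`) f) ` parcs (coset_graph C)"
      by (simp add: coset_graph_def Let_def V_def W_def)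
  qed
qed

section \<open>The adjoint of \<open>\<phi>\<close>\<close>

text \<open>A block (y1, y2, y3) goes to y1 + y2 \<open>\<omega>\<^sup>2\<close> + y3
  \<open>\<omega>\<close>. The coefficients are the squares of the multipliers 1,
  \<open>\<omega>\<close>, \<open>\<omega>\<^sup>2\<close> in the trace form of \<open>phi\<close>,
  because the trace inner product squares its second argument.\<close>

definition Psi :: "bit ^ ('n \<times> 3) \<Rightarrow> f4 ^ 'n" where
  "Psi y = (\<chi> i. F4 (y $ (i, 1) + y $ (i, 2)) (y $ (i, 2) + y $ (i, 3)))"

lemma phi_nth:
  "phi (F4 a b) $ 1 = b" "phi (F4 a b) $ 2 = a + b" "phi (F4 a b) $ 3 = a"
  by (simp_all add: vector_3)

lemma Psi_diff: "Psi (x - y) = Psi x - Psi y"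
  by (simp add: Psi_def vec_eq_iff minus_f4_def algebra_simps)

lemma Psi_add: "Psi (x + y) = Psi x + Psi y"
  by (simp add: Psi_def vec_eq_iff algebra_simps)

text \<open>In prime field coordinates the trace form is the symplectic form, whence its
  symmetry.\<close>

lemma Tr_mult_square: "Tr (F4 a b * (F4 c d)\<^sup>2) = F4 (a * d + b * c) 0"
  by (cases a; cases b; cases c; cases d) (simp_all add: Tr_def power2_eq_square)

lemma trace_inner_commute: "trace_inner x y = trace_inner y x"
proof -
  have "Tr (u * v\<^sup>2) = Tr (v * u\<^sup>2)" for u v
    by (cases u; cases v) (simp add: Tr_mult_square algebra_simps)
  then show ?thesis
    by (simp add: trace_inner_def)
qed

text \<open>Adjointness, checked on each block: a (y2 + y3) + b (y1 + y2) = b y1 + (a + b) y2 + a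
  y3.\<close>

lemma trace_inner_Psi:
  "trace_inner x (Psi y) = F4 (scalar_product (Phi x) y) 0"
proof -
  have sum_F4: "(\<Sum>i\<in>A. F4 (g i) 0) = F4 (\<Sum>i\<in>A. g i) 0" if "finite A" for A and g :: "'n \<Rightarrow> bit"
    using that by (induction A) (simp_all add: zero_f4_def)
  have "Tr (x $ i * (Psi y $ i)\<^sup>2) = F4 (\<Sum>j\<in>UNIV. Phi x $ (i, j) * y $ (i, j)) 0" for i
    by (cases "x $ i") (simp add: Psi_def Tr_mult_square Phi_def phi_nth sum_3 algebra_simps)
  then have "trace_inner x (Psi y) = F4 (\<Sum>i\<in>UNIV. \<Sum>j\<in>UNIV. Phi x $ (i, j) * y $ (i, j)) 0"
    by (simp add: trace_inner_def sum_F4)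
  then show ?thesis
    by (simp add: scalar_product_def sum.cartesian_product case_prod_unfold)
qed

lemma trace_inner_Psi_eq_0_iff:
  "trace_inner x (Psi y) = 0 \<longleftrightarrow> scalar_product (Phi x) y = 0"
  by (simp add: trace_inner_Psi zero_f4_def)

text \<open>A fibre of \<open>Psi\<close> leaves one free bit per block, recorded here by the first
  coordinate. This yields both surjectivity and the size of preimages.\<close>

lemma bij_betw_Psi_fibres:
  "bij_betw (\<lambda>y. (Psi y, \<chi> i. y $ (i, 1))) UNIV (UNIV :: ((f4 ^ 'n) \<times> (bit ^ 'n)) set)"
proof (rule bij_betw_byWitness)
  \<comment> \<open>Solves a = y1 + y2 and b = y2 + y3 for y2 and y3, given y1 = z.\<close>
  let ?g = "\<lambda>(q :: f4 ^ 'n, z :: bit ^ 'n). \<chi> p. (case q $ fst p of F4 a b \<Rightarrow>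
    if snd p = (1::3) then z $ fst p else if snd p = 2 then a + z $ fst p else a + b + z $ fst p)"
  have bit: "a + b + a = b" "a + (a + b) = b" "a + b + b = a" for a b :: bit
    by (cases a; cases b; simp)+
  have "?g (Psi y, \<chi> i. y $ (i, 1)) $ (i, j) = y $ (i, j)" for y i and j :: 3
    using exhaust_3[of j] bit[of "y $ (i,1)"]
    by (auto simp: Psi_def algebra_simps)
  then show "\<forall>y\<in>UNIV. ?g (Psi y, \<chi> i. y $ (i, 1)) = y"
    by (simp add: vec_eq_iff)
  have "Psi (?g (q, z)) $ i = q $ i" for q z i
    by (cases "q $ i") (auto simp: Psi_def bit algebra_simps)
  then show "\<forall>a\<in>UNIV. (\<lambda>y. (Psi y, \<chi> i. y $ (i, 1))) (?g a) = a"
    by (auto simp: vec_eq_iff split: f4.split)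
qed auto

lemma surj_Psi: "surj (Psi :: bit ^ ('n \<times> 3) \<Rightarrow> f4 ^ 'n)"
proof -
  have "\<exists>y. Psi y = q" for q :: "f4 ^ 'n"
    using bij_betw_imp_surj_on[OF bij_betw_Psi_fibres]
    by (metis (no_types, lifting) UNIV_I imageE prod.inject)
  then show ?thesis by (metis surjI)
qed

lemma card_vimage_Psi:
  fixes Q :: "(f4 ^ 'n) set"
  shows "card (Psi -` Q) = card Q * 2 ^ CARD('n)"
proof -
  let ?h = "\<lambda>y. (Psi y, \<chi> i. y $ (i, 1)) :: (f4 ^ 'n) \<times> (bit ^ 'n)"
  have "?h ` (Psi -` Q) = Q \<times> UNIV"
  proof
    show "Q \<times> UNIV \<subseteq> ?h ` (Psi -` Q)"
    proof
      fix p assume p: "p \<in> Q \<times> (UNIV :: (bit ^ 'n) set)"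
      obtain y where "p = ?h y"
        using bij_betw_imp_surj_on[OF bij_betw_Psi_fibres] by blast
      with p show "p \<in> ?h ` (Psi -` Q)" by auto
    qed
  qed auto
  moreover have "inj_on ?h (Psi -` Q)"
    using bij_betw_imp_inj_on[OF bij_betw_Psi_fibres] by (rule inj_on_subset) simp
  ultimately have "card (Psi -` Q) = card (Q \<times> (UNIV :: (bit ^ 'n) set))"
    using card_image by fastforce
  moreover have "card (UNIV :: (bit ^ 'n) set) = 2 ^ CARD('n)"
  proof -
    have "(UNIV :: bit set) = {0, 1}" by (auto intro: bit.exhaust)
    then have "CARD(bit) = 2" by (metis card_2_iff zero_neq_one)
    then show ?thesis by simp
  qed
  ultimately show ?thesis
    by (simp add: card_cartesian_product)
qed

lemma subspace_vimage_Psi: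
  assumes "additive_code Q"
  shows "vec.subspace (Psi -` Q)"
proof -
  have "Psi (0 :: bit ^ ('a \<times> 3)) = 0"
    using Psi_diff[of 0 0] by simp
  then show ?thesis
    using assms by (simp add: subspace_bit_iff additive_code_def Psi_add)
qed

lemma binary_dual_vimage_Psi:
  assumes "0 \<in> Q"
  shows "binary_dual (Psi -` Q) = Phi ` trace_dual Q"
proof
  show "Phi ` trace_dual Q \<subseteq> binary_dual (Psi -` Q)"
    by (auto simp: binary_dual_def trace_dual_def scalar_product_commute[of _ "Phi _"]
        trace_inner_commute[of "Psi _"] simp flip: trace_inner_Psi_eq_0_iff)
  show "binary_dual (Psi -` Q) \<subseteq> Phi ` trace_dual Q"
  proof
    fix z assume z: "z \<in> binary_dual (Psi -` Q)"
    have sum_block: "z $ (i, 1) + z $ (i, 2) + z $ (i, 3) = 0" for i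
    proof -
      \<comment> \<open>The indicator of block \<open>i\<close> lies in the kernel of
        \<open>Psi\<close>, hence in the preimage of \<open>Q\<close>, so \<open>z\<close> is
        orthogonal to it.\<close>
      let ?y = "(\<chi> p. if fst p = i then 1 else 0) :: bit ^ ('a \<times> 3)"
      have "Psi ?y = 0"
        by (simp add: Psi_def vec_eq_iff zero_f4_def)
      then have "scalar_product ?y z = 0"
        using z assms by (simp add: binary_dual_def)
      moreover have "scalar_product ?y z = (\<Sum>k\<in>UNIV. \<Sum>j\<in>UNIV. ?y $ (k, j) * z $ (k, j))"
        by (simp only: scalar_product_def sum.cartesian_product case_prod_unfold UNIV_Times_UNIV prod.collapse)
      moreover have "\<dots> = (\<Sum>k\<in>UNIV. if k = i then \<Sum>j\<in>UNIV. z $ (k, j) else 0)"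
        by (intro sum.cong) auto
      ultimately show ?thesis
        by (simp add: sum_3)
    qed
    \<comment> \<open>Inverts \<open>phi\<close> by reading a from the third and b from the first
      bit of a block; \<open>sum_block\<close> makes the middle bit agree.\<close>
    define x where "x = (\<chi> i. F4 (z $ (i, 3)) (z $ (i, 1)))"
    have "Phi x $ (i, j) = z $ (i, j)" for i j
      using exhaust_3[of j] sum_block[of i]
      by (cases "z $ (i, 1)"; cases "z $ (i, 2)"; cases "z $ (i, 3)")
        (auto simp: Phi_def x_def phi_nth)
    then have x: "Phi x = z"
      by (simp add: vec_eq_iff)
    have "trace_inner q x = 0" if "q \<in> Q" for q
    proof -
      obtain y where y: "Psi y = q" using surj_Psi by (metis surjD)
      then have "scalar_product y z = 0"
        using that z by (auto simp: binary_dual_def)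
      then show ?thesis
        using y by (metis scalar_product_commute trace_inner_Psi_eq_0_iff trace_inner_commute x)
    qed
    then show "z \<in> Phi ` trace_dual Q"
      using x by (auto simp: trace_dual_def)
  qed
qed

section \<open>Weights\<close>

lemma inj_Phi: "inj Phi"
proof (rule injI)
  fix x y :: "f4 ^ 'n"
  assume *: "Phi x = Phi y"
  have "x $ i = y $ i" for i
  proof -
    have "phi (x $ i) $ j = phi (y $ i) $ j" for j
      using arg_cong[OF *, of "\<lambda>v. v $ (i, j)"] by (simp add: Phi_def)
    then show ?thesis
      by (cases "x $ i"; cases "y $ i") (metis phi_nth(1,3))
  qed
  then show "x = y" by (simp add: vec_eq_iff)
qed

text \<open>If a and b are not both 0, exactly two of the bits b, a + b, a are 1.\<close>

lemma hamming_weight_Phi: "hamming_weight (Phi x) = 2 * hamming_weight x"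
proof -
  have block: "card {j. phi c $ j \<noteq> 0} = (if c = 0 then 0 else 2)" for c
  proof -
    obtain a b where c: "c = F4 a b" by (cases c)
    have "{j. phi c $ j \<noteq> 0} = (if b \<noteq> 0 then {1} else {}) \<union> (if a + b \<noteq> 0 then {2} else {})
      \<union> (if a \<noteq> 0 then {3} else {})"
    proof (rule set_eqI)
      fix j :: 3
      show "j \<in> {j. phi c $ j \<noteq> 0} \<longleftrightarrow> j \<in> (if b \<noteq> 0 then {1} else {})
        \<union> (if a + b \<noteq> 0 then {2} else {}) \<union> (if a \<noteq> 0 then {3} else {})"
        using exhaust_3[of j] by (elim disjE) (simp_all only: c phi_nth, simp_all)
    qed
    then show ?thesis
      by (cases a; cases b) (simp_all add: c zero_f4_def)
  qed
  have "{p. Phi x $ p \<noteq> 0} = Sigma UNIV (\<lambda>i. {j. phi (x $ i) $ j \<noteq> 0})"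
    by (auto simp: Phi_def)
  then have "hamming_weight (Phi x) = (\<Sum>i\<in>UNIV. card {j. phi (x $ i) $ j \<noteq> 0})"
    unfolding hamming_weight_def by (simp del: bit_not_zero_iff)
  also have "\<dots> = (\<Sum>i\<in>UNIV. if x $ i = 0 then 0 else 2)"
    by (simp add: block del: bit_not_zero_iff)
  also have "\<dots> = 2 * hamming_weight x"
    by (simp add: hamming_weight_def sum.If_cases Collect_neg_eq)
  finally show ?thesis .
qed

section \<open>Vectors of weight 1 and their images under \<open>Psi\<close>\<close>

lemma hamming_weight_1_iff:
  "hamming_weight x = 1 \<longleftrightarrow> (\<exists>i c. c \<noteq> 0 \<and> x = axis i c)"
proof
  assume "hamming_weight x = 1"
  then obtain i where i: "{j. x $ j \<noteq> 0} = {i}"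
    unfolding hamming_weight_def by (auto simp: card_1_singleton_iff)
  then have "x = axis i (x $ i)" "x $ i \<noteq> 0"
    by (auto simp: vec_eq_iff axis_def)
  then show "\<exists>i c. c \<noteq> 0 \<and> x = axis i c" by blast
next
  assume "\<exists>i c. c \<noteq> 0 \<and> x = axis i c"
  then obtain i c where "c \<noteq> 0" "x = axis i c" by blast
  then have "{j. x $ j \<noteq> 0} = {i}"
    by (auto simp: axis_def)
  then show "hamming_weight x = 1"
    by (simp add: hamming_weight_def)
qed

text \<open>The three unit vectors of a block reach the three nonzero field elements 1,
  \<open>\<omega>\<^sup>2\<close>, \<open>\<omega>\<close>, so that weight 1 is both preserved and
  liftable.\<close>

lemma Psi_axis:
  "Psi (axis (i, 1) 1) = axis i (F4 1 0)"
  "Psi (axis (i, 2) 1) = axis i (F4 1 1)"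
  "Psi (axis (i, 3) 1) = axis i (F4 0 1)"
  by (auto simp: Psi_def vec_eq_iff axis_def zero_f4_def)

lemma hamming_weight_1_Psi:
  assumes "hamming_weight y = 1"
  shows "hamming_weight (Psi y) = 1"
proof -
  obtain i j where "y = axis (i, j) 1"
    using assms unfolding hamming_weight_1_iff by auto
  then have "Psi y \<in> {axis i (F4 1 0), axis i (F4 1 1), axis i (F4 0 1)}"
    using exhaust_3[of j] by (auto simp: Psi_axis)
  moreover have "F4 1 0 \<noteq> 0" "F4 1 1 \<noteq> 0" "F4 0 1 \<noteq> 0"
    by (simp_all add: zero_f4_def)
  ultimately show ?thesis
    unfolding hamming_weight_1_iff by blast
qed

lemma hamming_weight_1_lift_Psi:
  assumes "hamming_weight q = 1"
  shows "\<exists>y. hamming_weight y = 1 \<and> Psi y = q"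
proof -
  obtain i c where ic: "c \<noteq> 0" "q = axis i c"
    using assms unfolding hamming_weight_1_iff by auto
  obtain a b where "c = F4 a b" by (cases c)
  with ic(1) have "c = F4 1 0 \<or> c = F4 1 1 \<or> c = F4 0 1"
    by (cases a; cases b) (auto simp: zero_f4_def)
  then have "\<exists>j. Psi (axis (i, j) 1) = q"
    using ic(2) Psi_axis by metis
  then show ?thesis
    by (metis hamming_weight_1_iff zero_neq_one)
qed

theorem theorem6:
  fixes Q :: "(f4 ^ 'n) set" and B :: "(bit ^ ('n \<times> 3)) set" and k :: real
  assumes "additive_code Q"
    and "real (card Q) = 4 powr k"
    and "B = binary_dual (Phi ` trace_dual Q)"
  shows "binary_linear_code B (3 * CARD('n)) (real CARD('n) + 2 * k)
    \<and> (\<forall>w. is_weight (trace_dual Q) w \<longrightarrow>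
          is_weight (binary_dual B) (2 * w) \<and>
          weight_freq (binary_dual B) (2 * w) = weight_freq (trace_dual Q) w)
    \<and> (\<forall>v. is_weight (binary_dual B) v \<longrightarrow>
          (\<exists>w. is_weight (trace_dual Q) w \<and> v = 2 * w))
    \<and> digraph_iso (with_proj (coset_graph Q)) (with_proj (coset_graph B))"
proof -
  have sub: "vec.subspace (Psi -` Q)"
    by (rule subspace_vimage_Psi[OF assms(1)])
  have dual: "binary_dual (Psi -` Q) = Phi ` trace_dual Q"
    using assms(1) by (simp add: additive_code_def binary_dual_vimage_Psi)
  \<comment> \<open>By \<open>dual\<close>, \<open>B\<close> is the double dual of the subspace
    \<open>Psi -\<close> applied to \<open>Q\<close>.\<close>
  have B: "B = Psi -` Q"
    using assms(3) binary_dual_dual[OF sub] by (simp add: dual)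
  have B_dual: "binary_dual B = Phi ` trace_dual Q"
    by (simp add: B dual)
  \<comment> \<open>The dimension is found by comparing exponents of 2 in the size of
    \<open>B\<close>; real powers are used because \<open>k\<close> is real.\<close>
  have "2 powr real (vec.dim B) = real (card B)"
    using card_subspace_bit[OF sub] by (simp add: B powr_realpow)
  also have "\<dots> = 4 powr k * 2 powr real CARD('n)"
    by (simp add: B card_vimage_Psi assms(2) powr_realpow)
  also have "4 powr k = (2 powr 2) powr k"
    by simp
  also have "(2 powr 2) powr k * 2 powr real CARD('n) = 2 powr (real CARD('n) + 2 * k)"
    by (simp only: powr_powr powr_add mult.commute)
  finally have "real (vec.dim B) = real CARD('n) + 2 * k"
    by (simp add: powr_inj)
  then have "binary_linear_code B (3 * CARD('n)) (real CARD('n) + 2 * k)"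
    using sub by (simp add: binary_linear_code_def B)
  moreover have "weight_freq (Phi ` trace_dual Q) (2 * w) = weight_freq (trace_dual Q) w" for w
  proof -
    \<comment> \<open>Doubling of weights matches the two weight classes, and injectivity of
      \<open>Phi\<close> then equates their sizes.\<close>
    have "{z \<in> Phi ` trace_dual Q. hamming_weight z = 2 * w}
      = Phi ` {x \<in> trace_dual Q. hamming_weight x = w}"
      by (auto simp: hamming_weight_Phi)
    then show ?thesis
      by (simp add: weight_freq_def card_image inj_on_subset[OF inj_Phi subset_UNIV])
  qed
  moreover have "digraph_iso (with_proj (coset_graph Q)) (with_proj (coset_graph B))"
    unfolding B
    by (rule coset_graph_vimage_iso[OF Psi_diff surj_Psi hamming_weight_1_Psi hamming_weight_1_lift_Psi])
  ultimately show ?thesis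
    by (auto simp: B_dual is_weight_def hamming_weight_Phi)
qed

end
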